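(* Let $\Omega\subset\mathbb{C}$ be a simply connected open domain. Suppose that $\nabla v\neq 0$ in $\Omega$. Then $\phi=u+i\,v$ is a solution in $\Omega$ of the eikonal equation $$\phi_x^2+\phi_y^2=1\qquad(\text{equivalently } 4\,\phi_z\,\phi_{\bar z}=1)$$ if and only if there exists an analytic function $f(\zeta)$ such that $$z=\frac{f(\zeta)+\zeta^2\,\overline{f(\zeta)}}{1-|\zeta|^4},$$ $$\phi=\frac{1}{1-|\zeta|^4}\left\{\zeta\,\overline{f(\zeta)}+\frac{f(\zeta)}{\zeta}\right\}-\frac{f(\zeta)}{2\zeta}+\frac12\int\frac{f(\zeta)}{\zeta^2}\,d\zeta.$$
   Context: Here $z=x+i\,y$, $u$ and $v$ are real-valued, $\partial_z=\frac12(\partial_x-i\,\partial_y)$, $\partial_{\bar z}=\frac12(\partial_x+i\,\partial_y)$, and subscripts denote derivatives. The eikonal equation is considered in the plane with index of refraction normalized to $1$. The two formulas are a parametrization $\zeta\mapsto(z(\zeta),\phi(\zeta))$ of $\phi$ as a function of $z$ by a complex parameter $\zeta$; for a solution $\phi$, the parameter is the function $\zeta=\zeta(z,\bar z)$ defined by $\phi_z=\frac{1}{2\zeta}$, $\phi_{\bar z}=\frac{\zeta}{2}$, and it is taken to be non-constant. The integral denotes an antiderivative of $f(\zeta)/\zeta^2$. Functions are assumed as regular as the computations require, and the parametrization is meant to have a local character.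
   Formalization: The formulas are asserted locally, near every point of Ω outside a set without limit point in Ω consisting of points where ζ is not locally one-to-one; at such branch points (e.g. ζ=1/2+w², f=w at w=0) no single-valued analytic f(ζ) exists, so the claim as stated fails there. *)

theory Defs
  imports "HOL-Analysis.Analysis"
begin

definition dx :: "(complex \<Rightarrow> 'a::real_normed_vector) \<Rightarrow> complex \<Rightarrow> 'a" where
  "dx g z = frechet_derivative g (at z) 1"

definition dy :: "(complex \<Rightarrow> 'a::real_normed_vector) \<Rightarrow> complex \<Rightarrow> 'a" where
  "dy g z = frechet_derivative g (at z) \<i>"

definition grad :: "(complex \<Rightarrow> real) \<Rightarrow> complex \<Rightarrow> real \<times> real" where
  "grad v z = (dx v z, dy v z)"

definition dz :: "(complex \<Rightarrow> complex) \<Rightarrow> complex \<Rightarrow> complex" where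
  "dz g z = (dx g z - \<i> * dy g z) / 2"

definition dzbar :: "(complex \<Rightarrow> complex) \<Rightarrow> complex \<Rightarrow> complex" where
  "dzbar g z = (dx g z + \<i> * dy g z) / 2"

(* Real differentiability classes, for functions of (x, y) on an open set. *)

definition C1_on :: "(complex \<Rightarrow> complex) \<Rightarrow> complex set \<Rightarrow> bool" where
  "C1_on g \<Omega> \<longleftrightarrow> (\<forall>z\<in>\<Omega>. g differentiable (at z)) \<and> continuous_on \<Omega> (dx g) \<and> continuous_on \<Omega> (dy g)"

definition C2_on :: "(complex \<Rightarrow> complex) \<Rightarrow> complex set \<Rightarrow> bool" where
  "C2_on g \<Omega> \<longleftrightarrow> C1_on g \<Omega> \<and> C1_on (dx g) \<Omega> \<and> C1_on (dy g) \<Omega>"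

definition eikonal_on :: "(complex \<Rightarrow> complex) \<Rightarrow> complex set \<Rightarrow> bool" where
  "eikonal_on \<phi> \<Omega> \<longleftrightarrow> (\<forall>z\<in>\<Omega>. (dx \<phi> z)\<^sup>2 + (dy \<phi> z)\<^sup>2 = 1)"

lemma eikonal_on_iff_wirtinger: "eikonal_on \<phi> \<Omega> \<longleftrightarrow> (\<forall>z\<in>\<Omega>. 4 * dz \<phi> z * dzbar \<phi> z = 1)"
proof -
  have "4 * dz \<phi> z * dzbar \<phi> z = (dx \<phi> z)\<^sup>2 + (dy \<phi> z)\<^sup>2" for z
    by (simp add: dz_def dzbar_def field_simps power2_eq_square)
  then show ?thesis by (simp add: eikonal_on_def)
qed

(* For a solution of the eikonal equation, dzbar \<phi> = \<zeta> / 2 already entails dz \<phi> = 1 / (2 \<zeta>). *)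
definition zeta :: "(complex \<Rightarrow> complex) \<Rightarrow> complex \<Rightarrow> complex" where
  "zeta \<phi> z = 2 * dzbar \<phi> z"

definition z_param :: "(complex \<Rightarrow> complex) \<Rightarrow> complex \<Rightarrow> complex" where
  "z_param f \<zeta> = (f \<zeta> + \<zeta>\<^sup>2 * cnj (f \<zeta>)) / of_real (1 - cmod \<zeta> ^ 4)"

(* P stands for the antiderivative of f(\<zeta>) / \<zeta>^2. *)
definition phi_param ::
  "(complex \<Rightarrow> complex) \<Rightarrow> (complex \<Rightarrow> complex) \<Rightarrow> complex \<Rightarrow> complex" where
  "phi_param f P \<zeta> =
     1 / of_real (1 - cmod \<zeta> ^ 4) * (\<zeta> * cnj (f \<zeta>) + f \<zeta> / \<zeta>) - f \<zeta> / (2 * \<zeta>) + P \<zeta> / 2"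

(* Over U, the function \<phi> is parametrized by \<zeta> ranging over D.  Nothing here ties \<zeta> to the
   derivatives of \<phi>: it is a free parameter. *)
definition parametrizes ::
  "(complex \<Rightarrow> complex) \<Rightarrow> (complex \<Rightarrow> complex) \<Rightarrow> complex set \<Rightarrow>
   complex set \<Rightarrow> (complex \<Rightarrow> complex) \<Rightarrow> bool" where
  "parametrizes f P D U \<phi> \<longleftrightarrow>
     (\<forall>\<zeta>\<in>D. \<zeta> \<noteq> 0 \<and> cmod \<zeta> \<noteq> 1) \<and>
     f analytic_on D \<and>
     (\<forall>\<zeta>\<in>D. (P has_field_derivative f \<zeta> / \<zeta>\<^sup>2) (at \<zeta>)) \<and>
     bij_betw (z_param f) D U \<and>
     (\<forall>\<zeta>\<in>D. \<phi> (z_param f \<zeta>) = phi_param f P \<zeta>)"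

definition locally_parametrized_at :: "(complex \<Rightarrow> complex) \<Rightarrow> complex set \<Rightarrow> complex \<Rightarrow> bool" where
  "locally_parametrized_at \<phi> \<Omega> z0 \<longleftrightarrow>
     (\<exists>U D f P. open U \<and> z0 \<in> U \<and> U \<subseteq> \<Omega> \<and> open D \<and> parametrizes f P D U \<phi>)"

(* Branch points: where zeta \<phi> is not locally one-to-one, so that z is not a single-valued function
   of it.  They do occur: if g and h are holomorphic near w0 with g' having an isolated zero at w0,
   h'(w0) \<noteq> 0, g(w0) \<noteq> 0 and |g(w0)| < 1, then
   \<zeta> = g(w), f = h(w), z = (h + g^2 cnj h) / (1 - |g|^4) gives a smooth solution near z(w0)
   for which f, as a function of \<zeta>, has a branch point at g(w0). *)
definition branch_points :: "(complex \<Rightarrow> complex) \<Rightarrow> complex set \<Rightarrow> complex set" where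
  "branch_points \<phi> \<Omega> = {z \<in> \<Omega>. \<nexists>U. open U \<and> z \<in> U \<and> inj_on (zeta \<phi>) U}"

end

theory Submission
  imports Defs "HOL-Complex_Analysis.Conformal_Mappings"
begin

text \<open>
  Everything rests on one observation. Put \<open>\<zeta> = 2 \<phi>\<^bsub>zbar\<^esub>\<close>, so that the eikonal equation says
  \<open>\<phi>\<^sub>z = 1 / (2 \<zeta>)\<close>. Equality of the mixed derivatives of \<open>\<phi>\<close> then becomes the quasilinear Beltrami
  equation \<open>\<zeta>\<^bsub>zbar\<^esub> = - \<zeta>\<^sup>2 \<zeta>\<^sub>z\<close>: the differential of \<open>\<zeta>\<close> is a complex multiple of the real-linear map
  \<open>L h = h - \<zeta>\<^sup>2 cnj h\<close>. This map is invertible unless \<open>|\<zeta>| = 1\<close>, and \<open>|\<zeta>| = 1\<close> would make both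
  \<open>\<phi>\<^sub>x\<close> and \<open>\<phi>\<^sub>y\<close> real, that is, \<open>grad v = 0\<close>. Two further functions have differentials that
  are multiples of the same \<open>L\<close>, namely \<open>F = z - \<zeta>\<^sup>2 cnj z\<close> and \<open>Q = 2 \<phi> - z / \<zeta> - \<zeta> cnj z\<close>:
  \<open>dF = (1 - 2 \<zeta> cnj z \<zeta>\<^sub>z) L\<close> and \<open>dQ = (F / \<zeta>\<^sup>2) \<zeta>\<^sub>z L\<close>.
  Whenever one function of this family is used as a local coordinate, all the others become
  holomorphic functions of it, with the quotient of the multipliers as derivative
  (\<open>beltrami_local_coordinate\<close>).

  Near a point with \<open>\<zeta>\<^sub>z \<noteq> 0\<close> the coordinate is \<open>\<zeta>\<close> itself. Then \<open>F\<close> and \<open>Q\<close> become holomorphic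
  functions \<open>f\<close> and \<open>P\<close> of \<open>\<zeta>\<close> with \<open>P' = f / \<zeta>\<^sup>2\<close>, and solving \<open>f = z - \<zeta>\<^sup>2 cnj z\<close> for \<open>z\<close> and the
  definition of \<open>Q\<close> for \<open>\<phi>\<close> gives the two formulas (\<open>locally_parametrized_regular\<close>).

  At a point with \<open>\<zeta>\<^sub>z = 0\<close> the multiplier of \<open>dF\<close> equals \<open>1\<close>, so \<open>F\<close> is a coordinate nearby and \<open>\<zeta>\<close> is a
  holomorphic function of \<open>F\<close> with a critical point there. Hence \<open>\<zeta>\<close> is not injective near such a
  point, and these points are isolated unless \<open>\<zeta>\<close> is locally constant, which connectedness of the
  domain excludes (\<open>critical_imp_branch_point\<close>, \<open>critical_sparse\<close>). The exceptional set is the set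
  of zeros of \<open>\<zeta>\<^sub>z\<close>.

  Conversely, let \<open>z = Z(\<zeta>)\<close> and \<open>\<phi>\<close> be given by the formulas. Differentiating \<open>f = Z - \<zeta>\<^sup>2 cnj Z\<close>
  gives \<open>L (dZ) = (f' + 2 \<zeta> cnj Z) d\<zeta>\<close>, so at each point \<open>dZ\<close> is either invertible or zero.
  Where it is invertible, the formula for \<open>\<phi>\<close> yields \<open>d\<phi> = dz / (2 \<zeta>) + (\<zeta> / 2) d(cnj z)\<close>, which is
  the eikonal equation. But \<open>dZ\<close> cannot vanish on an open set since \<open>Z\<close> is injective, so the equation
  extends by continuity to all parametrized points, and then across the sparse exceptional set.
\<close>

section \<open>Symmetry of mixed directional derivatives\<close>

lemma has_real_derivative_along_line:
  fixes f :: "'a::real_normed_vector \<Rightarrow> real"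
  assumes "(f has_derivative f') (at (a + s *\<^sub>R d))"
  shows "((\<lambda>s. f (a + s *\<^sub>R d)) has_real_derivative f' d) (at s)"
proof -
  have lin: "linear f'"
    using assms by (simp add: has_derivative_linear)
  have "((\<lambda>s. f (a + s *\<^sub>R d)) has_derivative (\<lambda>t. f' (t *\<^sub>R d))) (at s)"
    by (rule has_derivative_compose[where f = "\<lambda>s. a + s *\<^sub>R d" and g = f, OF _ assms])
       (auto intro!: derivative_eq_intros)
  moreover have "f' (t *\<^sub>R d) = f' d * t" for t
    using linear_scale[OF lin] by simp
  ultimately show ?thesis
    by (simp add: has_field_derivative_def)
qed

text \<open>
  The mean value theorem is used once along each side of the parallelogram. The second difference
  is symmetric in the two directions while the right-hand side is not; comparing both orders gives
  the symmetry of mixed derivatives.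
\<close>

lemma second_difference_mean_value:
  fixes g :: "'a::real_normed_vector \<Rightarrow> real"
  assumes g: "\<And>y. y \<in> ball x r \<Longrightarrow> (g has_derivative G y) (at y)"
    and D: "\<And>y. y \<in> ball x r \<Longrightarrow> ((\<lambda>y. G y d) has_derivative D y) (at y)"
    and t: "0 < t" "t * (norm d + norm e) < r"
  obtains p where "dist x p \<le> t * (norm d + norm e)"
    and "g (x + t *\<^sub>R d + t *\<^sub>R e) - g (x + t *\<^sub>R d) - g (x + t *\<^sub>R e) + g x = t\<^sup>2 * D p e"
proof -
  have near: "dist x (x + s *\<^sub>R d + s' *\<^sub>R e) \<le> t * (norm d + norm e)"
    if "0 \<le> s" "s \<le> t" "0 \<le> s'" "s' \<le> t" for s s'
  proof -
    have "norm (s *\<^sub>R d + s' *\<^sub>R e) \<le> s * norm d + s' * norm e"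
      using norm_triangle_ineq[of "s *\<^sub>R d" "s' *\<^sub>R e"] that by simp
    also have "\<dots> \<le> t * norm d + t * norm e"
      using that by (intro add_mono mult_right_mono) auto
    finally show ?thesis
      unfolding dist_commute[of x] by (simp add: dist_norm add.assoc distrib_left)
  qed
  have inb: "x + s *\<^sub>R d + s' *\<^sub>R e \<in> ball x r"
    if "0 \<le> s" "s \<le> t" "0 \<le> s'" "s' \<le> t" for s s'
    using near[OF that] t by simp
  \<comment> \<open>The increment of \<open>g\<close> over the side \<open>t e\<close>, as a function of the position along \<open>d\<close>.\<close>
  define k where "k = (\<lambda>s. g (x + t *\<^sub>R e + s *\<^sub>R d) - g (x + s *\<^sub>R d))"
  have k': "(k has_real_derivative (G (x + t *\<^sub>R e + s *\<^sub>R d) d - G (x + s *\<^sub>R d) d)) (at s)"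
    if "0 \<le> s" "s \<le> t" for s
    unfolding k_def
    using inb[of s t] inb[of s 0] that t
    by (intro DERIV_diff has_real_derivative_along_line g) (auto simp: add_ac)
  obtain s where s: "0 < s" "s < t"
    and ks: "k t - k 0 = (t - 0) * (G (x + t *\<^sub>R e + s *\<^sub>R d) d - G (x + s *\<^sub>R d) d)"
    using MVT2[OF t(1) k'] by auto
  define m where "m = (\<lambda>q. G (x + s *\<^sub>R d + q *\<^sub>R e) d)"
  have m': "(m has_real_derivative D (x + s *\<^sub>R d + q *\<^sub>R e) e) (at q)"
    if "0 \<le> q" "q \<le> t" for q
    unfolding m_def
    using inb[of s q] that s
    by (intro has_real_derivative_along_line[where f = "\<lambda>y. G y d"] D) auto
  obtain q where q: "0 < q" "q < t" and mq: "m t - m 0 = (t - 0) * D (x + s *\<^sub>R d + q *\<^sub>R e) e"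
    using MVT2[OF t(1) m'] by auto
  show thesis
  proof
    show "dist x (x + s *\<^sub>R d + q *\<^sub>R e) \<le> t * (norm d + norm e)"
      using near s q by simp
    have "k t - k 0 = t * (m t - m 0)"
      using ks by (simp add: m_def add_ac)
    then show "g (x + t *\<^sub>R d + t *\<^sub>R e) - g (x + t *\<^sub>R d) - g (x + t *\<^sub>R e) + g x
        = t\<^sup>2 * D (x + s *\<^sub>R d + q *\<^sub>R e) e"
      using mq by (simp add: k_def add_ac power2_eq_square algebra_simps)
  qed
qed

text \<open>
  If the values differed, continuity would keep the two mixed derivatives apart on a small ball,
  while the two ways of expanding one second difference produce equal values at points of that ball.
\<close>

lemma mixed_derivatives_commute_real:
  fixes g :: "'a::real_normed_vector \<Rightarrow> real"
  assumes S: "open S" "x \<in> S"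
    and g: "\<And>y. y \<in> S \<Longrightarrow> (g has_derivative G y) (at y)"
    and D: "\<And>y. y \<in> S \<Longrightarrow> ((\<lambda>y. G y d) has_derivative D y) (at y)"
    and E: "\<And>y. y \<in> S \<Longrightarrow> ((\<lambda>y. G y e) has_derivative E y) (at y)"
    and cont: "continuous_on S (\<lambda>y. D y e)" "continuous_on S (\<lambda>y. E y d)"
  shows "D x e = E x d"
proof (rule ccontr)
  assume ne: "D x e \<noteq> E x d"
  define \<epsilon> where "\<epsilon> = \<bar>D x e - E x d\<bar> / 2"
  have \<epsilon>: "\<epsilon> > 0" using ne by (simp add: \<epsilon>_def)
  have "isCont (\<lambda>y. D y e) x" "isCont (\<lambda>y. E y d) x"
    using cont S by (auto simp: continuous_on_eq_continuous_at)
  then obtain r1 r2 where r1: "r1 > 0" "\<And>y. dist y x < r1 \<Longrightarrow> dist (D y e) (D x e) < \<epsilon>"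
    and r2: "r2 > 0" "\<And>y. dist y x < r2 \<Longrightarrow> dist (E y d) (E x d) < \<epsilon>"
    using \<epsilon> unfolding continuous_at_eps_delta dist_real_def dist_norm real_norm_def by metis
  obtain r3 where r3: "r3 > 0" "ball x r3 \<subseteq> S"
    using S open_contains_ball by blast
  define r where "r = min r1 (min r2 r3)"
  have r: "r > 0" "ball x r \<subseteq> S" "r \<le> r1" "r \<le> r2"
    using r1 r2 r3 by (auto simp: r_def)
  \<comment> \<open>The summand \<open>1\<close> keeps \<open>N\<close> positive when both directions vanish.\<close>
  define N where "N = norm d + norm e + 1"
  define t where "t = r / (2 * N)"
  have N: "N > 0" by (simp add: N_def add_nonneg_pos)
  have t: "t > 0" using r N by (simp add: t_def)
  have "t * (norm d + norm e) \<le> t * N"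
    using t by (simp add: N_def)
  also have "\<dots> < r" using N r by (simp add: t_def)
  finally have tr: "t * (norm d + norm e) < r" .
  then have tr': "t * (norm e + norm d) < r" by (simp add: add.commute)
  obtain p where p: "dist x p \<le> t * (norm d + norm e)"
    "g (x + t *\<^sub>R d + t *\<^sub>R e) - g (x + t *\<^sub>R d) - g (x + t *\<^sub>R e) + g x = t\<^sup>2 * D p e"
    using second_difference_mean_value[of x r g G d D t e] g D r(2) t tr by blast
  obtain q where q: "dist x q \<le> t * (norm e + norm d)"
    "g (x + t *\<^sub>R e + t *\<^sub>R d) - g (x + t *\<^sub>R e) - g (x + t *\<^sub>R d) + g x = t\<^sup>2 * E q d"
    using second_difference_mean_value[of x r g G e E t d] g E r(2) t tr' by blast
  have "t\<^sup>2 * D p e = t\<^sup>2 * E q d"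
    unfolding p(2)[symmetric] q(2)[symmetric] by (simp add: add_ac)
  then have "D p e = E q d" using t by simp
  moreover have "dist (D p e) (D x e) < \<epsilon>"
    using r1(2)[of p] p(1) tr r by (simp add: dist_commute)
  moreover have "dist (E q d) (E x d) < \<epsilon>"
    using r2(2)[of q] q(1) tr' r by (simp add: dist_commute)
  ultimately show False
    using dist_triangle_half_r[of "D p e" "D x e" "2 * \<epsilon>" "E x d"]
    by (simp add: \<epsilon>_def dist_real_def)
qed

text \<open>
  The scalar case applied to the component of \<open>g\<close> along the difference \<open>c\<close> of the two sides gives
  \<open>c \<bullet> c = 0\<close>.
\<close>

lemma mixed_derivatives_commute:
  fixes g :: "'a::real_normed_vector \<Rightarrow> 'b::real_inner"
  assumes S: "open S" "x \<in> S"
    and g: "\<And>y. y \<in> S \<Longrightarrow> (g has_derivative G y) (at y)"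
    and D: "\<And>y. y \<in> S \<Longrightarrow> ((\<lambda>y. G y d) has_derivative D y) (at y)"
    and E: "\<And>y. y \<in> S \<Longrightarrow> ((\<lambda>y. G y e) has_derivative E y) (at y)"
    and cont: "continuous_on S (\<lambda>y. D y e)" "continuous_on S (\<lambda>y. E y d)"
  shows "D x e = E x d"
proof -
  define c where "c = D x e - E x d"
  have "D x e \<bullet> c = E x d \<bullet> c"
    by (rule mixed_derivatives_commute_real[OF S, of "\<lambda>y. g y \<bullet> c" "\<lambda>y h. G y h \<bullet> c" d
          "\<lambda>y h. D y h \<bullet> c" e "\<lambda>y h. E y h \<bullet> c"])
       (intro has_derivative_inner_left g D E continuous_intros cont; assumption)+
  then have "c \<bullet> c = 0"
    by (simp add: c_def inner_diff_left)
  then show ?thesis by (simp add: c_def)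
qed

section \<open>Wirtinger derivatives and the map with Beltrami coefficient\<close>

lemma has_derivative_wirtinger:
  fixes g :: "complex \<Rightarrow> complex"
  assumes "g differentiable (at z)"
  shows "(g has_derivative (\<lambda>h. dz g z * h + dzbar g z * cnj h)) (at z)"
proof -
  let ?D = "frechet_derivative g (at z)"
  have D: "(g has_derivative ?D) (at z)"
    using assms frechet_derivative_works by blast
  then have lin: "linear ?D" by (simp add: has_derivative_linear)
  have "?D h = dz g z * h + dzbar g z * cnj h" for h
  proof -
    have "?D h = ?D (Re h *\<^sub>R 1 + Im h *\<^sub>R \<i>)"
      by (intro arg_cong[where f = ?D]) (simp add: complex_eq_iff)
    also have "\<dots> = Re h *\<^sub>R dx g z + Im h *\<^sub>R dy g z"
      by (simp only: linear_add[OF lin] linear_scale[OF lin] dx_def dy_def)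
    finally show ?thesis
      by (simp add: dz_def dzbar_def complex_eq_iff field_simps)
  qed
  then have "?D = (\<lambda>h. dz g z * h + dzbar g z * cnj h)" ..
  then show ?thesis using D by simp
qed

lemma dx_dy_eqI:
  assumes "(g has_derivative g') (at z)"
  shows "dx g z = g' 1" "dy g z = g' \<i>"
  using frechet_derivative_at[OF assms] by (simp_all add: dx_def dy_def)

text \<open>
  A function satisfies the Beltrami equation \<open>g\<^bsub>zbar\<^esub> = - \<mu>\<^sup>2 g\<^sub>z\<close> at a point exactly if its differential
  there is a complex multiple of this map.
\<close>

definition beltrami :: "complex \<Rightarrow> complex \<Rightarrow> complex" where
  "beltrami \<mu> h = h - \<mu>\<^sup>2 * cnj h"

definition beltrami_inv :: "complex \<Rightarrow> complex \<Rightarrow> complex" where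
  "beltrami_inv \<mu> k = (k + \<mu>\<^sup>2 * cnj k) / of_real (1 - cmod \<mu> ^ 4)"

lemma z_param_eq: "z_param f \<zeta> = beltrami_inv \<zeta> (f \<zeta>)"
  by (simp add: z_param_def beltrami_inv_def)

lemma cmod_power4_eq: "complex_of_real (cmod \<mu> ^ 4) = \<mu>\<^sup>2 * (cnj \<mu>)\<^sup>2"
proof -
  have "complex_of_real (cmod \<mu> ^ 4) = (complex_of_real ((cmod \<mu>)\<^sup>2))\<^sup>2"
    by (simp flip: power_mult of_real_power)
  also have "\<dots> = \<mu>\<^sup>2 * (cnj \<mu>)\<^sup>2"
    by (simp only: complex_norm_square power_mult_distrib)
  finally show ?thesis .
qed

lemma beltrami_denom_nonzero:
  assumes "cmod \<mu> \<noteq> 1" shows "1 - \<mu>\<^sup>2 * (cnj \<mu>)\<^sup>2 \<noteq> 0"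
proof
  assume "1 - \<mu>\<^sup>2 * (cnj \<mu>)\<^sup>2 = 0"
  then have "complex_of_real (cmod \<mu> ^ 4) = 1"
    unfolding cmod_power4_eq by simp
  then have "cmod \<mu> ^ 4 = 1"
    using of_real_eq_1_iff by blast
  then show False using assms
    using power_eq_imp_eq_base[of "cmod \<mu>" 4 1] by simp
qed

lemma beltrami_inv_eq: "beltrami_inv \<mu> k = (k + \<mu>\<^sup>2 * cnj k) / (1 - \<mu>\<^sup>2 * (cnj \<mu>)\<^sup>2)"
  unfolding beltrami_inv_def of_real_diff cmod_power4_eq by simp

lemma beltrami_inv_beltrami:
  assumes "cmod \<mu> \<noteq> 1" shows "beltrami_inv \<mu> (beltrami \<mu> h) = h"
proof -
  have "beltrami \<mu> h + \<mu>\<^sup>2 * cnj (beltrami \<mu> h) = h * (1 - \<mu>\<^sup>2 * (cnj \<mu>)\<^sup>2)"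
    by (simp add: beltrami_def algebra_simps)
  then show ?thesis
    using beltrami_denom_nonzero[OF assms] by (simp add: beltrami_inv_eq)
qed

lemma beltrami_beltrami_inv:
  assumes "cmod \<mu> \<noteq> 1" shows "beltrami \<mu> (beltrami_inv \<mu> k) = k"
proof -
  let ?N = "1 - \<mu>\<^sup>2 * (cnj \<mu>)\<^sup>2"
  have N: "cnj ?N = ?N"
    by (simp add: mult.commute)
  have "beltrami \<mu> (beltrami_inv \<mu> k)
      = (k + \<mu>\<^sup>2 * cnj k) / ?N - \<mu>\<^sup>2 * (cnj (k + \<mu>\<^sup>2 * cnj k) / ?N)"
    unfolding beltrami_def beltrami_inv_eq complex_cnj_divide N ..
  also have "\<dots> = k * ?N / ?N"
    by (simp add: algebra_simps flip: add_divide_distrib diff_divide_distrib)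
  finally show ?thesis
    using beltrami_denom_nonzero[OF assms] by simp
qed

lemma bounded_linear_beltrami: "bounded_linear (\<lambda>h. a * beltrami \<mu> h)"
  unfolding beltrami_def by (intro bounded_linear_intros bounded_linear_cnj)

lemma bounded_linear_beltrami_inv: "bounded_linear (\<lambda>k. beltrami_inv \<mu> (k / a))"
  unfolding beltrami_inv_def divide_inverse
  by (intro bounded_linear_intros bounded_linear_compose[OF bounded_linear_cnj])

text \<open>
  If the differentials of \<open>G\<close> and \<open>H\<close> are \<open>a L\<close> and \<open>b L\<close> with the same invertible real-linear
  \<open>L\<close>, then in \<open>dH \<circ> inv dG\<close> the non-holomorphic factor \<open>L\<close> cancels and multiplication by \<open>b / a\<close>
  remains. So \<open>H\<close> is a holomorphic function of \<open>G\<close> wherever \<open>G\<close> is a local coordinate, which the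
  inverse function theorem provides near \<open>z0\<close>.
\<close>

lemma beltrami_local_coordinate:
  fixes G \<mu> a :: "complex \<Rightarrow> complex"
  assumes \<Omega>: "open \<Omega>" "z0 \<in> \<Omega>"
    and \<mu>: "\<And>z. z \<in> \<Omega> \<Longrightarrow> cmod (\<mu> z) \<noteq> 1" "continuous_on \<Omega> \<mu>"
    and a: "continuous_on \<Omega> a" "a z0 \<noteq> 0"
    and G: "\<And>z. z \<in> \<Omega> \<Longrightarrow> (G has_derivative (\<lambda>h. a z * beltrami (\<mu> z) h)) (at z)"
  obtains U D \<psi> where "open U" "z0 \<in> U" "U \<subseteq> \<Omega>" "open D" "homeomorphism U D G \<psi>"
    "\<And>z. z \<in> U \<Longrightarrow> a z \<noteq> 0"
    "\<And>H b w. \<lbrakk>w \<in> D; (H has_derivative (\<lambda>h. b * beltrami (\<mu> (\<psi> w)) h)) (at (\<psi> w))\<rbrakk>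
        \<Longrightarrow> ((\<lambda>w. H (\<psi> w)) has_field_derivative b / a (\<psi> w)) (at w)"
proof -
  define G' where "G' z = Blinfun (\<lambda>h. a z * beltrami (\<mu> z) h)" for z
  define I where "I = Blinfun (\<lambda>k. beltrami_inv (\<mu> z0) (k / a z0))"
  have G'_apply: "blinfun_apply (G' z) = (\<lambda>h. a z * beltrami (\<mu> z) h)" for z
    unfolding G'_def by (rule bounded_linear_Blinfun_apply[OF bounded_linear_beltrami])
  have I_apply: "blinfun_apply I = (\<lambda>k. beltrami_inv (\<mu> z0) (k / a z0))"
    unfolding I_def by (rule bounded_linear_Blinfun_apply[OF bounded_linear_beltrami_inv])
  have cont: "continuous_on \<Omega> G'"
    unfolding beltrami_def
    by (rule continuous_on_blinfun_componentwise, unfold G'_apply beltrami_def)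
       (intro continuous_intros a \<mu>)
  have inv: "I o\<^sub>L G' z0 = id_blinfun"
    using a \<mu>(1)[OF \<Omega>(2)]
    by (intro blinfun_eqI) (simp add: G'_apply I_apply beltrami_inv_beltrami)
  have der: "(G has_derivative blinfun_apply (G' z)) (at z)" if "z \<in> \<Omega>" for z
    unfolding G'_apply by (rule G[OF that])
  obtain U V \<psi> \<psi>' where U: "open U" "U \<subseteq> \<Omega>" "z0 \<in> U" "open V" "homeomorphism U V G \<psi>"
    and \<psi>: "\<And>w. w \<in> V \<Longrightarrow> (\<psi> has_derivative \<psi>' w) (at w)"
      "\<And>w. w \<in> V \<Longrightarrow> \<psi>' w = inv (blinfun_apply (G' (\<psi> w)))"
    and bij: "\<And>w. w \<in> V \<Longrightarrow> bij (blinfun_apply (G' (\<psi> w)))"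
    by (rule inverse_function_theorem[OF \<Omega>(1) der cont \<Omega>(2) inv]) blast+
  have nz: "a z \<noteq> 0" if "z \<in> U" for z
  proof
    assume "a z = 0"
    have "G z \<in> V" "\<psi> (G z) = z" using U(5) that by (auto simp: homeomorphism_def)
    then have "bij (\<lambda>h. a z * beltrami (\<mu> z) h)"
      using bij[of "G z"] by (simp add: G'_apply)
    with \<open>a z = 0\<close> have "inj (\<lambda>h::complex. 0::complex)"
      by (simp add: bij_is_inj)
    then have "(0::complex) = 1" by (rule injD) simp
    then show False by simp
  qed
  show thesis
  proof (rule that[OF U(1,3,2,4,5) nz], assumption)
    fix H b w
    assume w: "w \<in> V" and H: "(H has_derivative (\<lambda>h. b * beltrami (\<mu> (\<psi> w)) h)) (at (\<psi> w))"
    have "\<psi> w \<in> U" using U(5) w by (auto simp: homeomorphism_def)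
    then have "a (\<psi> w) \<noteq> 0" by (rule nz)
    moreover have "a (\<psi> w) * beltrami (\<mu> (\<psi> w)) (\<psi>' w k) = k" for k
      using surj_f_inv_f[OF bij_is_surj[OF bij[OF w]], of k] \<psi>(2)[OF w] by (simp add: G'_apply)
    ultimately have "beltrami (\<mu> (\<psi> w)) (\<psi>' w k) = k / a (\<psi> w)" for k
      by (simp add: nonzero_eq_divide_eq mult.commute)
    then have "(\<lambda>k. b * beltrami (\<mu> (\<psi> w)) (\<psi>' w k)) = (*) (b / a (\<psi> w))"
      by (simp add: fun_eq_iff)
    then show "((\<lambda>w. H (\<psi> w)) has_field_derivative b / a (\<psi> w)) (at w)"
      using has_derivative_compose[OF \<psi>(1)[OF w] H] by (simp add: has_field_derivative_def)
  qed
qed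

text \<open>
  The first formula of the representation is the equation \<open>f = z - \<zeta>\<^sup>2 cnj z\<close> solved for \<open>z\<close>.
\<close>

lemma z_param_beltrami:
  assumes "cmod \<zeta> \<noteq> 1"
  shows "f \<zeta> = beltrami \<zeta> (z_param f \<zeta>)"
  by (simp add: z_param_eq beltrami_beltrami_inv[OF assms])

text \<open>
  Written in terms of \<open>z\<close> instead of \<open>f\<close>, the second formula loses its denominator: the fraction is
  \<open>z / \<zeta>\<close>, because \<open>\<zeta> cnj f + f / \<zeta> = (f + \<zeta>\<^sup>2 cnj f) / \<zeta>\<close>.
\<close>

lemma phi_param_eq:
  assumes "\<zeta> \<noteq> 0" "cmod \<zeta> \<noteq> 1"
  shows "phi_param f P \<zeta> = (z_param f \<zeta> / \<zeta> + \<zeta> * cnj (z_param f \<zeta>) + P \<zeta>) / 2"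
proof -
  define z where "z = z_param f \<zeta>"
  have f: "f \<zeta> = z - \<zeta>\<^sup>2 * cnj z"
    using z_param_beltrami[OF assms(2)] by (simp add: z_def beltrami_def)
  have "\<zeta> * cnj (f \<zeta>) + f \<zeta> / \<zeta> = (f \<zeta> + \<zeta>\<^sup>2 * cnj (f \<zeta>)) / \<zeta>"
    using assms by (simp add: field_simps power2_eq_square)
  then have "1 / of_real (1 - cmod \<zeta> ^ 4) * (\<zeta> * cnj (f \<zeta>) + f \<zeta> / \<zeta>) = z / \<zeta>"
    by (simp add: z_def z_param_def mult.commute)
  moreover have "f \<zeta> / (2 * \<zeta>) = z / (2 * \<zeta>) - \<zeta> * cnj z / 2"
    using assms by (simp add: f field_simps power2_eq_square)
  ultimately have "phi_param f P \<zeta> = z / \<zeta> - (z / (2 * \<zeta>) - \<zeta> * cnj z / 2) + P \<zeta> / 2"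
    by (simp only: phi_param_def)
  also have "\<dots> = (z / \<zeta> + \<zeta> * cnj z + P \<zeta>) / 2"
    by (simp add: field_simps)
  finally show ?thesis by (simp add: z_def)
qed

section \<open>The parameter of a solution\<close>

lemma zeta_eq: "zeta \<phi> z = dx \<phi> z + \<i> * dy \<phi> z"
  by (simp add: zeta_def dzbar_def)

lemma eikonal_wirtinger:
  assumes "eikonal_on \<phi> \<Omega>" "z \<in> \<Omega>"
  shows "zeta \<phi> z \<noteq> 0" "dz \<phi> z = 1 / (2 * zeta \<phi> z)"
proof -
  have *: "4 * dz \<phi> z * dzbar \<phi> z = 1"
    using assms unfolding eikonal_on_iff_wirtinger by blast
  then show "zeta \<phi> z \<noteq> 0" by (auto simp: zeta_def)
  then show "dz \<phi> z = 1 / (2 * zeta \<phi> z)"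
    using * by (simp add: zeta_def field_simps)
qed

text \<open>
  If \<open>|\<zeta>| = 1\<close> then \<open>1 / \<zeta> = cnj \<zeta>\<close>, so \<open>d\<phi> h = Re (cnj \<zeta> h)\<close> is real and the gradient of the
  imaginary part vanishes.
\<close>

lemma eikonal_cmod_zeta:
  assumes "eikonal_on \<phi> \<Omega>" "z \<in> \<Omega>" "open \<Omega>" "C1_on \<phi> \<Omega>"
    and uv: "\<And>z. z \<in> \<Omega> \<Longrightarrow> \<phi> z = complex_of_real (u z) + \<i> * complex_of_real (v z)"
    and grad: "grad v z \<noteq> 0"
  shows "cmod (zeta \<phi> z) \<noteq> 1"
proof
  assume 1: "cmod (zeta \<phi> z) = 1"
  let ?\<zeta> = "zeta \<phi> z"
  have "dz \<phi> z = ?\<zeta> * cnj ?\<zeta> / (2 * ?\<zeta>)"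
    using 1 complex_norm_square[of ?\<zeta>] eikonal_wirtinger(2)[OF assms(1,2)] by simp
  then have dz: "dz \<phi> z = cnj ?\<zeta> / 2"
    using eikonal_wirtinger(1)[OF assms(1,2)] by simp
  have dzbar: "dzbar \<phi> z = ?\<zeta> / 2" by (simp add: zeta_def)
  have "\<phi> differentiable (at z)"
    using assms(2,4) by (simp add: C1_on_def)
  then have "(\<phi> has_derivative (\<lambda>h. cnj ?\<zeta> / 2 * h + ?\<zeta> / 2 * cnj h)) (at z)"
    by (rule has_derivative_wirtinger[of \<phi> z, unfolded dz dzbar])
  then have "((\<lambda>z. Im (\<phi> z)) has_derivative (\<lambda>h. Im (cnj ?\<zeta> / 2 * h + ?\<zeta> / 2 * cnj h))) (at z)"
    by (rule bounded_linear.has_derivative[OF bounded_linear_Im])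
  moreover have "(\<lambda>h. Im (cnj ?\<zeta> / 2 * h + ?\<zeta> / 2 * cnj h)) = (\<lambda>h. 0)"
    by (simp add: fun_eq_iff flip: add_divide_distrib)
  moreover have "Im (\<phi> w) = v w" if "w \<in> \<Omega>" for w
    by (simp add: uv[OF that])
  ultimately have "(v has_derivative (\<lambda>h. 0)) (at z)"
    using has_derivative_transform_within_open[OF _ \<open>open \<Omega>\<close> \<open>z \<in> \<Omega>\<close>] by metis
  then have "grad v z = 0"
    by (simp add: grad_def dx_dy_eqI zero_prod_def)
  with grad show False by blast
qed

locale eikonal_solution =
  fixes \<phi> :: "complex \<Rightarrow> complex" and \<Omega> :: "complex set"
  assumes open_dom: "open \<Omega>" and connected_dom: "connected \<Omega>"
    and C2: "C2_on \<phi> \<Omega>" and eikonal: "eikonal_on \<phi> \<Omega>"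
    and cmod_zeta: "\<And>z. z \<in> \<Omega> \<Longrightarrow> cmod (zeta \<phi> z) \<noteq> 1"
    and nonconstant: "\<not> zeta \<phi> constant_on \<Omega>"
begin

abbreviation \<zeta> :: "complex \<Rightarrow> complex" where "\<zeta> \<equiv> zeta \<phi>"

abbreviation \<zeta>\<^sub>z :: "complex \<Rightarrow> complex" where "\<zeta>\<^sub>z \<equiv> dz (zeta \<phi>)"

lemma zeta_nonzero: "z \<in> \<Omega> \<Longrightarrow> \<zeta> z \<noteq> 0"
  using eikonal_wirtinger[OF eikonal] by blast

lemma phi_has_derivative:
  assumes "z \<in> \<Omega>"
  shows "(\<phi> has_derivative (\<lambda>h. h / (2 * \<zeta> z) + \<zeta> z / 2 * cnj h)) (at z)"
proof -
  have "\<phi> differentiable (at z)"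
    using C2 assms by (simp add: C2_on_def C1_on_def)
  from has_derivative_wirtinger[OF this] show ?thesis
    using eikonal_wirtinger(2)[OF eikonal assms] by (simp add: zeta_def)
qed

text \<open>
  With \<open>p = \<phi>\<^sub>x\<close> and \<open>q = \<phi>\<^sub>y\<close> one has \<open>\<zeta> = p + i q\<close>. Differentiating \<open>p\<^sup>2 + q\<^sup>2 = 1\<close> in both
  coordinate directions and using \<open>p\<^sub>y = q\<^sub>x\<close> gives two linear relations between the second
  derivatives, which imply the Beltrami equation for \<open>\<zeta>\<close>.
\<close>

lemma zeta_derivatives:
  assumes z: "z \<in> \<Omega>"
  shows "\<zeta> differentiable (at z)" "dzbar \<zeta> z = - (\<zeta> z)\<^sup>2 * \<zeta>\<^sub>z z"
    "\<zeta>\<^sub>z z = (dx (dx \<phi>) z + dy (dy \<phi>) z) / 2"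
proof -
  define p q where "p = dx \<phi>" and "q = dy \<phi>"
  have zeta_pq: "\<zeta> = (\<lambda>z. p z + \<i> * q z)"
    by (simp add: fun_eq_iff zeta_eq p_def q_def)
  have diff: "(\<phi> has_derivative frechet_derivative \<phi> (at y)) (at y)"
    "(p has_derivative frechet_derivative p (at y)) (at y)"
    "(q has_derivative frechet_derivative q (at y)) (at y)" if "y \<in> \<Omega>" for y
    using C2 that
    by (simp_all add: C2_on_def C1_on_def p_def q_def flip: frechet_derivative_works)
  have pq: "(\<lambda>y. frechet_derivative \<phi> (at y) 1) = p" "(\<lambda>y. frechet_derivative \<phi> (at y) \<i>) = q"
    by (simp_all add: fun_eq_iff p_def q_def dx_def dy_def)
  have "frechet_derivative p (at z) \<i> = frechet_derivative q (at z) 1"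
  proof (rule mixed_derivatives_commute[OF open_dom z diff(1), where d = 1 and e = \<i>
        and D = "\<lambda>y. frechet_derivative p (at y)" and E = "\<lambda>y. frechet_derivative q (at y)"])
    show "continuous_on \<Omega> (\<lambda>y. frechet_derivative p (at y) \<i>)"
      "continuous_on \<Omega> (\<lambda>y. frechet_derivative q (at y) 1)"
      using C2 by (simp_all add: C2_on_def C1_on_def p_def q_def dx_def[abs_def] dy_def[abs_def])
  qed (simp_all add: pq diff)
  then have sym: "dy p z = dx q z" by (simp add: dx_def dy_def)
  let ?p' = "frechet_derivative p (at z)" and ?q' = "frechet_derivative q (at z)"
  have \<zeta>': "(\<zeta> has_derivative (\<lambda>h. ?p' h + \<i> * ?q' h)) (at z)"
    unfolding zeta_pq by (intro derivative_intros diff z)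
  then show "\<zeta> differentiable (at z)"
    by (auto simp: differentiable_def)
  have "((\<lambda>z. p z * p z + q z * q z) has_derivative
      (\<lambda>h. p z * ?p' h + ?p' h * p z + (q z * ?q' h + ?q' h * q z))) (at z)"
    by (intro derivative_intros diff z)
  moreover have "((\<lambda>z. p z * p z + q z * q z) has_derivative (\<lambda>h. 0)) (at z)"
    by (rule has_derivative_transform_within_open[OF has_derivative_const[of 1] open_dom z])
       (use eikonal in \<open>simp add: eikonal_on_def p_def q_def power2_eq_square\<close>)
  ultimately have "(\<lambda>h. p z * ?p' h + ?p' h * p z + (q z * ?q' h + ?q' h * q z)) = (\<lambda>h. 0)"
    by (rule has_derivative_unique)
  then have zero: "p z * ?p' h + q z * ?q' h = 0" for h
    by (simp add: fun_eq_iff algebra_simps)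
       (metis (no_types, lifting) distrib_left mult_2 mult_eq_0_iff zero_neq_numeral)
  have e1: "p z * dx p z + q z * dx q z = 0" and e2: "p z * dx q z + q z * dy q z = 0"
    using zero[of 1] zero[of \<i>] sym by (simp_all add: dx_def dy_def)
  have e3: "(p z)\<^sup>2 + (q z)\<^sup>2 = 1"
    using eikonal z by (simp add: eikonal_on_def p_def q_def)
  have dxy: "dx \<zeta> z = dx p z + \<i> * dx q z" "dy \<zeta> z = dx q z + \<i> * dy q z"
    using dx_dy_eqI[OF \<zeta>'] sym by (simp_all add: dx_def dy_def)
  show a: "\<zeta>\<^sub>z z = (dx (dx \<phi>) z + dy (dy \<phi>) z) / 2"
    unfolding p_def[symmetric] q_def[symmetric] dz_def dxy by (simp add: algebra_simps)
  have "dx p z + 2 * \<i> * dx q z - dy q z = - (p z + \<i> * q z)\<^sup>2 * (dx p z + dy q z)"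
    using e1 e2 e3 i_squared by algebra
  moreover have "dx p z + \<i> * dx q z + \<i> * (dx q z + \<i> * dy q z)
      = dx p z + 2 * \<i> * dx q z - dy q z"
    by (simp add: algebra_simps)
  ultimately show "dzbar \<zeta> z = - (\<zeta> z)\<^sup>2 * \<zeta>\<^sub>z z"
    unfolding a dzbar_def dxy
    unfolding zeta_pq p_def[symmetric] q_def[symmetric] by simp
qed

lemma zeta_has_derivative:
  "z \<in> \<Omega> \<Longrightarrow> (\<zeta> has_derivative (\<lambda>h. \<zeta>\<^sub>z z * beltrami (\<zeta> z) h)) (at z)"
  using has_derivative_wirtinger[OF zeta_derivatives(1), of z] zeta_derivatives(2)[of z]
  by (simp add: beltrami_def algebra_simps)

lemma continuous_zeta: "continuous_on \<Omega> \<zeta>"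
  using has_derivative_continuous[OF zeta_has_derivative]
  by (simp add: continuous_at_imp_continuous_on)

lemma continuous_zeta_dz: "continuous_on \<Omega> \<zeta>\<^sub>z"
proof -
  have "continuous_on \<Omega> (\<lambda>z. (dx (dx \<phi>) z + dy (dy \<phi>) z) / 2)"
    using C2 by (intro continuous_intros) (auto simp: C2_on_def C1_on_def)
  then show ?thesis
    by (rule continuous_on_eq) (simp add: zeta_derivatives(3))
qed

text \<open>
  The coefficient function of the representation, as a function of position; near
  points with \<open>\<zeta>\<^sub>z \<noteq> 0\<close> it is an analytic function of \<open>\<zeta>\<close>.
\<close>

definition F :: "complex \<Rightarrow> complex" where
  "F z = beltrami (\<zeta> z) z"

abbreviation F\<^sub>z :: "complex \<Rightarrow> complex" where
  "F\<^sub>z z \<equiv> 1 - 2 * \<zeta> z * cnj z * \<zeta>\<^sub>z z"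

lemma F_has_derivative:
  assumes "z \<in> \<Omega>"
  shows "(F has_derivative (\<lambda>h. F\<^sub>z z * beltrami (\<zeta> z) h)) (at z)"
proof -
  have "((\<lambda>z. z - \<zeta> z * \<zeta> z * cnj z) has_derivative (\<lambda>h. F\<^sub>z z * beltrami (\<zeta> z) h)) (at z)"
    by (rule has_derivative_eq_rhs, (rule derivative_intros zeta_has_derivative assms)+)
       (simp add: fun_eq_iff beltrami_def algebra_simps power2_eq_square)
  then show ?thesis
    by (simp add: F_def[abs_def] beltrami_def power2_eq_square)
qed

text \<open>
  The antiderivative of \<open>f / \<zeta>\<^sup>2\<close> as a function of position, found by solving the second formula
  (in the form of \<open>phi_param_eq\<close>) for it.
\<close>

definition Q :: "complex \<Rightarrow> complex" where
  "Q z = 2 * \<phi> z - z / \<zeta> z - \<zeta> z * cnj z"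

text \<open>
  In \<open>2 d\<phi> - d(z / \<zeta>) - d(\<zeta> cnj z)\<close> the terms with \<open>dz\<close> and \<open>d(cnj z)\<close> cancel, leaving
  \<open>(z / \<zeta>\<^sup>2 - cnj z) d\<zeta>\<close>.
\<close>

lemma Q_has_derivative:
  assumes "z \<in> \<Omega>"
  shows "(Q has_derivative (\<lambda>h. F z / (\<zeta> z)\<^sup>2 * \<zeta>\<^sub>z z * beltrami (\<zeta> z) h)) (at z)"
proof -
  let ?L = "beltrami (\<zeta> z)"
  have "((\<lambda>z. 2 * \<phi> z - z / \<zeta> z - \<zeta> z * cnj z) has_derivative
      (\<lambda>h. 2 * (h / (2 * \<zeta> z) + \<zeta> z / 2 * cnj h)
        - (- z * (inverse (\<zeta> z) * (\<zeta>\<^sub>z z * ?L h) * inverse (\<zeta> z)) + h / \<zeta> z)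
        - (\<zeta> z * cnj h + \<zeta>\<^sub>z z * ?L h * cnj z))) (at z)"
    by (intro derivative_intros zeta_has_derivative phi_has_derivative assms zeta_nonzero)
  moreover have "2 * (h / (2 * \<zeta> z) + \<zeta> z / 2 * cnj h)
        - (- z * (inverse (\<zeta> z) * (\<zeta>\<^sub>z z * ?L h) * inverse (\<zeta> z)) + h / \<zeta> z)
        - (\<zeta> z * cnj h + \<zeta>\<^sub>z z * ?L h * cnj z)
      = (z - (\<zeta> z)\<^sup>2 * cnj z) / (\<zeta> z)\<^sup>2 * \<zeta>\<^sub>z z * ?L h" for h
    using zeta_nonzero[OF assms] by (simp add: field_simps power2_eq_square)
  ultimately show ?thesis
    by (simp add: Q_def[abs_def] F_def beltrami_def[of _ z])
qed

text \<open>
  With \<open>\<zeta>\<close> as local coordinate, \<open>F\<close> and \<open>Q\<close> become the holomorphic functions \<open>f\<close> and \<open>P\<close>. The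
  multiplier \<open>\<zeta>\<^sub>z\<close> cancels in the derivative of \<open>P\<close>, which leaves \<open>f / \<zeta>\<^sup>2\<close>, and the map \<open>z_param f\<close>
  is the local inverse of \<open>\<zeta>\<close>.
\<close>

lemma locally_parametrized_regular:
  assumes z0: "z0 \<in> \<Omega>" and nz: "\<zeta>\<^sub>z z0 \<noteq> 0"
  shows "locally_parametrized_at \<phi> \<Omega> z0"
proof -
  obtain U D \<psi> where U: "open U" "z0 \<in> U" "U \<subseteq> \<Omega>" "open D"
    and hom: "homeomorphism U D \<zeta> \<psi>"
    and nzU: "\<And>z. z \<in> U \<Longrightarrow> \<zeta>\<^sub>z z \<noteq> 0"
    and chain: "\<And>H b w. \<lbrakk>w \<in> D; (H has_derivative (\<lambda>h. b * beltrami (\<zeta> (\<psi> w)) h)) (at (\<psi> w))\<rbrakk>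
        \<Longrightarrow> ((\<lambda>w. H (\<psi> w)) has_field_derivative b / \<zeta>\<^sub>z (\<psi> w)) (at w)"
    by (rule beltrami_local_coordinate[OF open_dom z0 cmod_zeta continuous_zeta
          continuous_zeta_dz nz zeta_has_derivative]) blast+
  have \<psi>: "\<psi> w \<in> U" "\<psi> w \<in> \<Omega>" "\<zeta> (\<psi> w) = w" if "w \<in> D" for w
    using hom that U(3) by (auto simp: homeomorphism_def)
  define f where "f w = F (\<psi> w)" for w
  define P where "P w = Q (\<psi> w)" for w
  have w: "w \<noteq> 0" "cmod w \<noteq> 1" if "w \<in> D" for w
    using zeta_nonzero[of "\<psi> w"] cmod_zeta[of "\<psi> w"] \<psi>[OF that] by auto
  have z: "z_param f w = \<psi> w" if "w \<in> D" for w
    using beltrami_inv_beltrami[OF w(2)[OF that]] \<psi>(3)[OF that]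
    by (simp add: z_param_eq f_def F_def)
  have "parametrizes f P D U \<phi>"
    unfolding parametrizes_def
  proof (intro conjI ballI)
    fix w assume D: "w \<in> D"
    show "w \<noteq> 0" "cmod w \<noteq> 1" using w[OF D] by auto
    show "(P has_field_derivative f w / w\<^sup>2) (at w)"
      using chain[OF D Q_has_derivative[OF \<psi>(2)[OF D]]] nzU[OF \<psi>(1)[OF D]]
      by (simp add: P_def[abs_def] f_def \<psi>(3)[OF D])
    show "\<phi> (z_param f w) = phi_param f P w"
      using phi_param_eq[OF w[OF D], of f P] by (simp add: z[OF D] P_def Q_def \<psi>(3)[OF D])
  next
    have "f holomorphic_on D"
      using chain[OF _ F_has_derivative[OF \<psi>(2)]] U(4)
      by (auto simp: holomorphic_on_open f_def[abs_def])
    then show "f analytic_on D" using U(4) by (simp add: analytic_on_open)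
    have "bij_betw \<psi> D U"
      using hom by (intro bij_betw_byWitness[where f' = \<zeta>]) (auto simp: homeomorphism_def)
    then show "bij_betw (z_param f) D U"
      using bij_betw_cong[of D "z_param f" \<psi> U] z by blast
  qed
  then show ?thesis
    unfolding locally_parametrized_at_def using U by blast
qed

text \<open>
  Where \<open>\<zeta>\<^sub>z\<close> vanishes, the multiplier \<open>1 - 2 \<zeta> cnj z \<zeta>\<^sub>z\<close> of \<open>dF\<close> is \<open>1\<close>. So \<open>F\<close> can replace
  \<open>\<zeta>\<close> as local coordinate, and the zeros of \<open>\<zeta>\<^sub>z\<close> become the zeros of a holomorphic derivative.
\<close>

lemma holomorphic_near_critical_point:
  assumes z0: "z0 \<in> \<Omega>" and crit: "\<zeta>\<^sub>z z0 = 0"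
  obtains U D \<psi> where "open U" "z0 \<in> U" "U \<subseteq> \<Omega>" "open D" "homeomorphism U D F \<psi>"
    "(\<lambda>w. \<zeta> (\<psi> w)) holomorphic_on D"
    "\<And>z. z \<in> U \<Longrightarrow> deriv (\<lambda>w. \<zeta> (\<psi> w)) (F z) = 0 \<longleftrightarrow> \<zeta>\<^sub>z z = 0"
proof -
  have cont: "continuous_on \<Omega> F\<^sub>z"
    by (intro continuous_intros continuous_zeta continuous_zeta_dz)
  have nz: "F\<^sub>z z0 \<noteq> 0" using crit by simp
  obtain U D \<psi> where U: "open U" "z0 \<in> U" "U \<subseteq> \<Omega>" "open D"
    and hom: "homeomorphism U D F \<psi>"
    and nzU: "\<And>z. z \<in> U \<Longrightarrow> F\<^sub>z z \<noteq> 0"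
    and chain: "\<And>H b w. \<lbrakk>w \<in> D; (H has_derivative (\<lambda>h. b * beltrami (\<zeta> (\<psi> w)) h)) (at (\<psi> w))\<rbrakk>
        \<Longrightarrow> ((\<lambda>w. H (\<psi> w)) has_field_derivative b / F\<^sub>z (\<psi> w)) (at w)"
    by (rule beltrami_local_coordinate[OF open_dom z0 cmod_zeta continuous_zeta
          cont nz F_has_derivative]) blast+
  have \<psi>: "\<psi> w \<in> \<Omega>" if "w \<in> D" for w
    using hom that U(3) by (auto simp: homeomorphism_def)
  have der: "((\<lambda>w. \<zeta> (\<psi> w)) has_field_derivative \<zeta>\<^sub>z (\<psi> w) / F\<^sub>z (\<psi> w)) (at w)" if "w \<in> D" for w
    by (rule chain[OF that zeta_has_derivative[OF \<psi>[OF that]]])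
  show thesis
  proof (rule that[OF U hom])
    show "(\<lambda>w. \<zeta> (\<psi> w)) holomorphic_on D"
      using der U(4) by (auto simp: holomorphic_on_open)
    fix z assume z: "z \<in> U"
    then have "F z \<in> D" "\<psi> (F z) = z" using hom by (auto simp: homeomorphism_def)
    then show "deriv (\<lambda>w. \<zeta> (\<psi> w)) (F z) = 0 \<longleftrightarrow> \<zeta>\<^sub>z z = 0"
      using DERIV_imp_deriv[OF der[of "F z"]] nzU[OF z] by simp
  qed
qed

text \<open>
  A holomorphic function is not injective near a zero of its derivative, and composing it with the
  homeomorphism \<open>F\<close> does not change this.
\<close>

lemma critical_imp_branch_point:
  assumes z0: "z0 \<in> \<Omega>" and crit: "\<zeta>\<^sub>z z0 = 0"
  shows "z0 \<in> branch_points \<phi> \<Omega>"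
proof -
  obtain U D \<psi> where U: "open U" "z0 \<in> U" "U \<subseteq> \<Omega>" "open D" "homeomorphism U D F \<psi>"
    and hol: "(\<lambda>w. \<zeta> (\<psi> w)) holomorphic_on D"
    and zero: "\<And>z. z \<in> U \<Longrightarrow> deriv (\<lambda>w. \<zeta> (\<psi> w)) (F z) = 0 \<longleftrightarrow> \<zeta>\<^sub>z z = 0"
    by (rule holomorphic_near_critical_point[OF assms]) blast
  have "\<not> inj_on \<zeta> W" if W: "open W" "z0 \<in> W" for W
  proof
    assume inj: "inj_on \<zeta> W"
    let ?D = "D \<inter> \<psi> -` W"
    have "continuous_on D \<psi>" using U(5) by (simp add: homeomorphism_def)
    then have "open ?D" by (rule continuous_open_preimage[OF _ U(4) W(1)])
    moreover have "(\<lambda>w. \<zeta> (\<psi> w)) holomorphic_on ?D"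
      using hol by (rule holomorphic_on_subset) blast
    moreover have "inj_on (\<lambda>w. \<zeta> (\<psi> w)) ?D"
    proof (rule inj_onI)
      fix w w' assume w: "w \<in> ?D" "w' \<in> ?D" "\<zeta> (\<psi> w) = \<zeta> (\<psi> w')"
      then have "\<psi> w = \<psi> w'" using inj by (auto dest: inj_onD)
      then show "w = w'" using U(5) w unfolding homeomorphism_def by (metis IntD1)
    qed
    moreover have "F z0 \<in> ?D"
      using U(2,5) W(2) by (auto simp: homeomorphism_def)
    ultimately have "deriv (\<lambda>w. \<zeta> (\<psi> w)) (F z0) \<noteq> 0"
      using holomorphic_injective_imp_regular by blast
    then show False using zero[OF U(2)] crit by blast
  qed
  then show ?thesis using z0 by (auto simp: branch_points_def)
qed

text \<open>
  The zeros of the holomorphic derivative of \<open>\<zeta>\<close> with respect to \<open>F\<close> are isolated, unless it vanishes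
  identically near the point.
\<close>

lemma critical_isolated_or_interior:
  assumes z0: "z0 \<in> \<Omega>"
  obtains W where "open W" "z0 \<in> W" "\<And>z. z \<in> W - {z0} \<Longrightarrow> \<zeta>\<^sub>z z \<noteq> 0"
  | W where "open W" "z0 \<in> W" "\<And>z. z \<in> W \<Longrightarrow> \<zeta>\<^sub>z z = 0"
proof (cases "\<zeta>\<^sub>z z0 = 0")
  case False
  have "open (\<Omega> \<inter> \<zeta>\<^sub>z -` (- {0}))"
    by (rule continuous_open_preimage[OF continuous_zeta_dz open_dom]) auto
  then show thesis using that(1)[of "\<Omega> \<inter> \<zeta>\<^sub>z -` (- {0})"] z0 False by auto
next
  case True
  obtain U D \<psi> where U: "open U" "z0 \<in> U" "U \<subseteq> \<Omega>" "open D" "homeomorphism U D F \<psi>"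
    and hol: "(\<lambda>w. \<zeta> (\<psi> w)) holomorphic_on D"
    and zero: "\<And>z. z \<in> U \<Longrightarrow> deriv (\<lambda>w. \<zeta> (\<psi> w)) (F z) = 0 \<longleftrightarrow> \<zeta>\<^sub>z z = 0"
    by (rule holomorphic_near_critical_point[OF z0 True]) blast
  let ?g' = "deriv (\<lambda>w. \<zeta> (\<psi> w))"
  have F0: "F z0 \<in> D" using U(2,5) by (auto simp: homeomorphism_def)
  then obtain r where r: "r > 0" "ball (F z0) r \<subseteq> D"
    using U(4) open_contains_ball by blast
  have open_pre: "open (U \<inter> F -` ball (F z0) s)" for s
    using U(5) by (intro continuous_open_preimage U(1)) (auto simp: homeomorphism_def)
  show thesis
  proof (cases "\<forall>w \<in> ball (F z0) r. ?g' w = 0")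
    case True
    show thesis
    proof (rule that(2)[OF open_pre[of r]])
      show "z0 \<in> U \<inter> F -` ball (F z0) r" using U(2) r(1) by simp
      show "\<zeta>\<^sub>z z = 0" if "z \<in> U \<inter> F -` ball (F z0) r" for z
        using that True zero[of z] by blast
    qed
  next
    case False
    then obtain \<beta> where \<beta>: "\<beta> \<in> ball (F z0) r" "?g' \<beta> \<noteq> 0" by blast
    have hol': "?g' holomorphic_on ball (F z0) r"
      using holomorphic_deriv[OF hol U(4)] r(2) holomorphic_on_subset by blast
    have z0': "F z0 \<in> ball (F z0) r" "?g' (F z0) = 0"
      using r(1) zero[OF U(2)] True by auto
    obtain s where s: "s > 0" "\<And>w. w \<in> ball (F z0) s - {F z0} \<Longrightarrow> ?g' w \<noteq> 0"
      by (rule isolated_zeros[OF hol' open_ball connected_ball z0' \<beta>]) blast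
    show thesis
    proof (rule that(1)[OF open_pre[of s]])
      show "z0 \<in> U \<inter> F -` ball (F z0) s" using U(2) s(1) by simp
      fix z assume z: "z \<in> U \<inter> F -` ball (F z0) s - {z0}"
      then have "F z \<noteq> F z0"
        using U(2,5) unfolding homeomorphism_def by (metis DiffE IntD1 singletonI)
      then show "\<zeta>\<^sub>z z \<noteq> 0" using s(2)[of "F z"] zero[of z] z by auto
    qed
  qed
qed

text \<open>
  The set \<open>K\<close>, near whose points \<open>\<zeta>\<^sub>z\<close> vanishes identically, and the set \<open>R\<close>, near whose points it
  has at most one zero, are open, disjoint, and cover the domain. By connectedness one of them is
  empty within the domain; if \<open>R\<close> were, \<open>\<zeta>\<close> would be constant.
\<close>

lemma critical_sparse: "{z \<in> \<Omega>. \<zeta>\<^sub>z z = 0} sparse_in \<Omega>"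
proof -
  define K where "K = \<Union>{W. open W \<and> W \<subseteq> \<Omega> \<and> (\<forall>z\<in>W. \<zeta>\<^sub>z z = 0)}"
  define R where "R = \<Union>{W. open W \<and> W \<subseteq> \<Omega> \<and> (\<exists>z0. \<forall>z\<in>W - {z0}. \<zeta>\<^sub>z z \<noteq> 0)}"
  have "open K" "open R" unfolding K_def R_def by blast+
  have cover: "\<Omega> \<subseteq> K \<union> R"
  proof
    fix z0 assume z0: "z0 \<in> \<Omega>"
    show "z0 \<in> K \<union> R"
    proof (rule critical_isolated_or_interior[OF z0])
      fix W assume "open W" "z0 \<in> W" "\<And>z. z \<in> W - {z0} \<Longrightarrow> \<zeta>\<^sub>z z \<noteq> 0"
      then have "W \<inter> \<Omega> \<in> {W. open W \<and> W \<subseteq> \<Omega> \<and> (\<exists>z0. \<forall>z\<in>W - {z0}. \<zeta>\<^sub>z z \<noteq> 0)}"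
        using open_dom by auto
      then show ?thesis unfolding R_def using z0 \<open>z0 \<in> W\<close> by blast
    next
      fix W assume "open W" "z0 \<in> W" "\<And>z. z \<in> W \<Longrightarrow> \<zeta>\<^sub>z z = 0"
      then have "W \<inter> \<Omega> \<in> {W. open W \<and> W \<subseteq> \<Omega> \<and> (\<forall>z\<in>W. \<zeta>\<^sub>z z = 0)}"
        using open_dom by auto
      then show ?thesis unfolding K_def using z0 \<open>z0 \<in> W\<close> by blast
    qed
  qed
  have disj: "K \<inter> R = {}"
  proof (rule ccontr)
    assume "K \<inter> R \<noteq> {}"
    then obtain W W' z1 z where W: "open W" "\<forall>z\<in>W. \<zeta>\<^sub>z z = 0" "z \<in> W"
      and W': "open W'" "\<forall>z\<in>W' - {z1}. \<zeta>\<^sub>z z \<noteq> 0" "z \<in> W'"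
      unfolding K_def R_def by blast
    have "W \<inter> W' \<subseteq> {z1}" using W W' by blast
    moreover have "z islimpt (W \<inter> W')"
      using W W' by (intro open_imp_islimpt) auto
    ultimately show False
      using islimpt_subset islimpt_finite[of "{z1}" z] by blast
  qed
  have "K \<inter> \<Omega> = {}"
  proof (rule ccontr)
    assume ne: "K \<inter> \<Omega> \<noteq> {}"
    have "R \<inter> \<Omega> = {}"
      using connectedD[OF connected_dom \<open>open K\<close> \<open>open R\<close>] disj cover ne by blast
    then have "\<zeta>\<^sub>z z = 0" if "z \<in> \<Omega>" for z
      using that cover by (auto simp: K_def)
    then have "(\<zeta> has_derivative (\<lambda>h. 0)) (at z)" if "z \<in> \<Omega>" for z
      using zeta_has_derivative[OF that] that by simp
    then have "\<zeta> x = \<zeta> y" if "x \<in> \<Omega>" "y \<in> \<Omega>" for x y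
      using has_derivative_zero_unique_connected[OF open_dom connected_dom] that by blast
    then have "\<zeta> constant_on \<Omega>" unfolding constant_on_def by blast
    with nonconstant show False by blast
  qed
  then have "\<not> z islimpt {z \<in> \<Omega>. \<zeta>\<^sub>z z = 0}" if "z \<in> \<Omega>" for z
  proof -
    have "z \<in> R" using \<open>K \<inter> \<Omega> = {}\<close> that cover by blast
    then obtain W z1 where W: "open W" "z \<in> W" "\<forall>z\<in>W - {z1}. \<zeta>\<^sub>z z \<noteq> 0"
      unfolding R_def by blast
    show ?thesis
    proof
      assume "z islimpt {z \<in> \<Omega>. \<zeta>\<^sub>z z = 0}"
      then have "z islimpt (W \<inter> {z \<in> \<Omega>. \<zeta>\<^sub>z z = 0})"
        using W by (metis islimpt_Int_eventually inf_commute eventually_at_in_open')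
      moreover have "W \<inter> {z \<in> \<Omega>. \<zeta>\<^sub>z z = 0} \<subseteq> {z1}" using W by blast
      ultimately show False
        using islimpt_subset islimpt_finite[of "{z1}" z] by blast
    qed
  qed
  then show ?thesis by (simp add: sparse_in_open[OF open_dom])
qed

end

section \<open>Parametrized functions solve the eikonal equation\<close>

text \<open>
  Differentiating \<open>f = Z - \<zeta>\<^sup>2 cnj Z\<close> shows how the differential of \<open>Z = z_param f\<close> can degenerate:
  it is invertible if the multiplier on the right-hand side is nonzero, and zero otherwise.
\<close>

lemma z_param_has_derivative:
  assumes D: "open D" "\<zeta> \<in> D" "\<And>\<zeta>. \<zeta> \<in> D \<Longrightarrow> cmod \<zeta> \<noteq> 1"
    and f: "(f has_field_derivative f') (at \<zeta>)"
  obtains Z' where "(z_param f has_derivative Z') (at \<zeta>)"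
    "\<And>h. beltrami \<zeta> (Z' h) = (f' + 2 * \<zeta> * cnj (z_param f \<zeta>)) * h"
proof -
  have f: "(f has_derivative (\<lambda>h. f' * h)) (at \<zeta>)"
    using f by (simp add: has_field_derivative_def)
  have "1 - \<zeta>\<^sup>2 * (cnj \<zeta>)\<^sup>2 \<noteq> 0"
    using beltrami_denom_nonzero D by blast
  moreover have "f differentiable (at \<zeta>)" "cnj differentiable (at \<zeta>)"
    "(\<lambda>\<zeta>. cnj (f \<zeta>)) differentiable (at \<zeta>)"
    by (rule differentiableI, rule has_derivative_cnj has_derivative_ident f,
        (rule has_derivative_ident f)?)+
  ultimately have "(\<lambda>\<zeta>. (f \<zeta> + \<zeta>\<^sup>2 * cnj (f \<zeta>)) / (1 - \<zeta>\<^sup>2 * (cnj \<zeta>)\<^sup>2)) differentiable (at \<zeta>)"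
    by (intro derivative_intros) auto
  then obtain Z' where Z: "(z_param f has_derivative Z') (at \<zeta>)"
    by (auto simp: z_param_eq[abs_def] beltrami_inv_eq differentiable_def)
  have "((\<lambda>\<zeta>. z_param f \<zeta> - \<zeta> * \<zeta> * cnj (z_param f \<zeta>)) has_derivative
      (\<lambda>h. Z' h - (\<zeta> * \<zeta> * cnj (Z' h) + (\<zeta> * h + h * \<zeta>) * cnj (z_param f \<zeta>)))) (at \<zeta>)"
    by (intro derivative_intros Z)
  moreover have "z_param f \<zeta> - \<zeta> * \<zeta> * cnj (z_param f \<zeta>) = f \<zeta>" if "\<zeta> \<in> D" for \<zeta>
    using z_param_beltrami[of \<zeta> f] D(3)[OF that] by (simp add: beltrami_def power2_eq_square)
  ultimately have "(f has_derivative
      (\<lambda>h. Z' h - (\<zeta> * \<zeta> * cnj (Z' h) + (\<zeta> * h + h * \<zeta>) * cnj (z_param f \<zeta>)))) (at \<zeta>)"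
    using has_derivative_transform_within_open[OF _ D(1,2)] by blast
  from has_derivative_unique[OF this f]
  have eq: "Z' h - (\<zeta> * \<zeta> * cnj (Z' h) + (\<zeta> * h + h * \<zeta>) * cnj (z_param f \<zeta>)) = f' * h" for h
    by (rule fun_cong)
  have "beltrami \<zeta> (Z' h) = (f' + 2 * \<zeta> * cnj (z_param f \<zeta>)) * h" for h
    using eq[of h] unfolding beltrami_def by algebra
  with Z show thesis by (rule that)
qed

text \<open>
  By \<open>phi_param_eq\<close>, \<open>2 \<phi>(Z) = Z / \<zeta> + \<zeta> cnj Z + P\<close>. Because \<open>P' = f / \<zeta>\<^sup>2\<close>, the terms with \<open>d\<zeta>\<close> cancel
  in the differential, so \<open>2 d\<phi>(dZ) = dZ / \<zeta> + \<zeta> cnj dZ\<close>. A nonzero multiplier makes \<open>dZ\<close>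
  onto, and then this determines \<open>d\<phi>\<close>.
\<close>

lemma parametrized_eikonal_regular:
  assumes D: "open D" "\<zeta> \<in> D" and par: "parametrizes f P D U \<phi>"
    and \<phi>: "\<phi> differentiable (at (z_param f \<zeta>))"
    and reg: "deriv f \<zeta> + 2 * \<zeta> * cnj (z_param f \<zeta>) \<noteq> 0"
  shows "(dx \<phi> (z_param f \<zeta>))\<^sup>2 + (dy \<phi> (z_param f \<zeta>))\<^sup>2 = 1"
proof -
  let ?z = "z_param f \<zeta>" and ?c = "deriv f \<zeta> + 2 * \<zeta> * cnj (z_param f \<zeta>)"
  have D': "\<zeta> \<noteq> 0" "cmod \<zeta> \<noteq> 1" if "\<zeta> \<in> D" for \<zeta>
    using par that by (auto simp: parametrizes_def)
  have "f holomorphic_on D"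
    using par analytic_imp_holomorphic by (auto simp: parametrizes_def)
  then have f: "(f has_field_derivative deriv f \<zeta>) (at \<zeta>)"
    using D holomorphic_derivI by blast
  have "(P has_field_derivative f \<zeta> / \<zeta>\<^sup>2) (at \<zeta>)"
    using par D by (auto simp: parametrizes_def)
  then have P: "(P has_derivative (\<lambda>h. f \<zeta> / \<zeta>\<^sup>2 * h)) (at \<zeta>)"
    unfolding has_field_derivative_def .
  obtain Z' where Z: "(z_param f has_derivative Z') (at \<zeta>)"
    and Z': "\<And>h. beltrami \<zeta> (Z' h) = ?c * h"
    using z_param_has_derivative[OF D D'(2) f] by blast
  obtain \<phi>' where \<phi>': "(\<phi> has_derivative \<phi>') (at ?z)"
    using \<phi> by (auto simp: differentiable_def)
  have lhs: "((\<lambda>\<zeta>. 2 * \<phi> (z_param f \<zeta>)) has_derivative (\<lambda>h. 2 * \<phi>' (Z' h))) (at \<zeta>)"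
    by (intro derivative_intros has_derivative_compose[OF Z \<phi>'])
  have rhs: "((\<lambda>\<zeta>. z_param f \<zeta> / \<zeta> + \<zeta> * cnj (z_param f \<zeta>) + P \<zeta>) has_derivative
      (\<lambda>h. Z' h / \<zeta> + \<zeta> * cnj (Z' h))) (at \<zeta>)"
  proof (rule has_derivative_eq_rhs)
    show "((\<lambda>\<zeta>. z_param f \<zeta> / \<zeta> + \<zeta> * cnj (z_param f \<zeta>) + P \<zeta>) has_derivative
        (\<lambda>h. - ?z * (inverse \<zeta> * h * inverse \<zeta>) + Z' h / \<zeta> + (\<zeta> * cnj (Z' h) + h * cnj ?z)
          + f \<zeta> / \<zeta>\<^sup>2 * h)) (at \<zeta>)"
      by (intro derivative_intros Z P D' D)
    have fz: "f \<zeta> = ?z - \<zeta>\<^sup>2 * cnj ?z"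
      using z_param_beltrami[OF D'(2)[OF D(2)]] by (simp add: beltrami_def)
    show "(\<lambda>h. - ?z * (inverse \<zeta> * h * inverse \<zeta>) + Z' h / \<zeta> + (\<zeta> * cnj (Z' h) + h * cnj ?z)
          + f \<zeta> / \<zeta>\<^sup>2 * h) = (\<lambda>h. Z' h / \<zeta> + \<zeta> * cnj (Z' h))"
      unfolding fz using D'(1)[OF D(2)] by (simp add: fun_eq_iff field_simps power2_eq_square)
  qed
  have eq: "z_param f \<zeta> / \<zeta> + \<zeta> * cnj (z_param f \<zeta>) + P \<zeta> = 2 * \<phi> (z_param f \<zeta>)"
    if "\<zeta> \<in> D" for \<zeta>
  proof -
    have "\<phi> (z_param f \<zeta>) = phi_param f P \<zeta>"
      using par that by (simp add: parametrizes_def)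
    then show ?thesis
      by (simp only: phi_param_eq[OF D'[OF that]]) simp
  qed
  have "(\<lambda>h. 2 * \<phi>' (Z' h)) = (\<lambda>h. Z' h / \<zeta> + \<zeta> * cnj (Z' h))"
    by (rule has_derivative_unique[OF lhs has_derivative_transform_within_open[OF rhs D eq]])
  then have eq: "2 * \<phi>' (Z' h) = Z' h / \<zeta> + \<zeta> * cnj (Z' h)" for h
    by (rule fun_cong)
  have \<phi>'_eq: "\<phi>' k = (k / \<zeta> + \<zeta> * cnj k) / 2" for k
  proof -
    \<comment> \<open>the preimage of \<open>k\<close> under \<open>dZ\<close>\<close>
    let ?h = "beltrami \<zeta> k / ?c"
    have "beltrami \<zeta> (Z' ?h) = beltrami \<zeta> k"
      using Z'[of ?h] reg by simp
    then have "Z' ?h = k"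
      using beltrami_inv_beltrami[OF D'(2)[OF D(2)]] by metis
    then have "2 * \<phi>' k = k / \<zeta> + \<zeta> * cnj k"
      using eq[of ?h] by simp
    then show ?thesis by (simp add: mult.commute)
  qed
  have dxy: "2 * dx \<phi> ?z = 1 / \<zeta> + \<zeta>" "2 * dy \<phi> ?z = \<i> * (1 / \<zeta>) - \<i> * \<zeta>"
    by (simp_all add: dx_dy_eqI[OF \<phi>'] \<phi>'_eq)
  have "1 / \<zeta> * \<zeta> = 1" using D'(1)[OF D(2)] by simp
  then have "4 * ((dx \<phi> ?z)\<^sup>2 + (dy \<phi> ?z)\<^sup>2) = 4 * 1"
    using dxy i_squared by algebra
  then show ?thesis
    by (rule mult_left_cancel[of 4, THEN iffD1, rotated]) simp
qed

text \<open>
  Were the equation to fail at some point, it would fail on a whole disc of parameters by continuity.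
  The multiplier \<open>f' + 2 \<zeta> cnj Z\<close> would then vanish on the disc, and with it the differential of \<open>Z\<close>,
  so \<open>Z\<close> would be constant there, although it is injective.
\<close>

lemma parametrized_eikonal:
  assumes D: "open D" and par: "parametrizes f P D U \<phi>" and C1: "C1_on \<phi> U"
  shows "eikonal_on \<phi> U"
proof -
  define Z where "Z = z_param f"
  define e where "e z = (dx \<phi> z)\<^sup>2 + (dy \<phi> z)\<^sup>2" for z
  have bij: "bij_betw Z D U" using par by (simp add: parametrizes_def Z_def)
  have nrm: "cmod \<zeta> \<noteq> 1" if "\<zeta> \<in> D" for \<zeta> using par that by (simp add: parametrizes_def)
  have hol: "f holomorphic_on D"
    using par analytic_imp_holomorphic by (auto simp: parametrizes_def)
  have Z': "\<exists>Z'. (Z has_derivative Z') (at \<zeta>) \<and>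
      (\<forall>h. beltrami \<zeta> (Z' h) = (deriv f \<zeta> + 2 * \<zeta> * cnj (Z \<zeta>)) * h)" if "\<zeta> \<in> D" for \<zeta>
    using z_param_has_derivative[OF D that nrm holomorphic_derivI[OF hol D that]]
    unfolding Z_def by metis
  have contZ: "continuous_on D Z"
  proof (intro continuous_at_imp_continuous_on ballI)
    show "isCont Z \<zeta>" if "\<zeta> \<in> D" for \<zeta>
      using Z'[OF that] has_derivative_continuous by blast
  qed
  have "continuous_on U e"
    unfolding e_def using C1 by (intro continuous_intros) (auto simp: C1_on_def)
  then have cont: "continuous_on D (\<lambda>\<zeta>. e (Z \<zeta>))"
    by (rule continuous_on_compose2[OF _ contZ]) (use bij in \<open>auto simp: bij_betw_def\<close>)
  have "e (Z \<zeta>0) = 1" if \<zeta>0: "\<zeta>0 \<in> D" for \<zeta>0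
  proof (rule ccontr)
    assume ne: "e (Z \<zeta>0) \<noteq> 1"
    have "open (D \<inter> (\<lambda>\<zeta>. e (Z \<zeta>)) -` (- {1}))"
      by (rule continuous_open_preimage[OF cont D]) auto
    moreover have "\<zeta>0 \<in> D \<inter> (\<lambda>\<zeta>. e (Z \<zeta>)) -` (- {1})" using \<zeta>0 ne by simp
    ultimately obtain r where r: "r > 0" "ball \<zeta>0 r \<subseteq> D \<inter> (\<lambda>\<zeta>. e (Z \<zeta>)) -` (- {1})"
      by (rule openE)
    have "(Z has_derivative (\<lambda>h. 0)) (at \<zeta>)" if "\<zeta> \<in> ball \<zeta>0 r" for \<zeta>
    proof -
      have \<zeta>: "\<zeta> \<in> D" "e (Z \<zeta>) \<noteq> 1" using r that by auto
      then have "Z \<zeta> \<in> U" using bij by (auto simp: bij_betw_def)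
      then have "\<phi> differentiable (at (Z \<zeta>))" using C1 by (simp add: C1_on_def)
      then have "deriv f \<zeta> + 2 * \<zeta> * cnj (Z \<zeta>) = 0"
        using parametrized_eikonal_regular[OF D \<zeta>(1) par] \<zeta>(2) unfolding e_def Z_def by blast
      then obtain Z' where "(Z has_derivative Z') (at \<zeta>)" "\<And>h. beltrami \<zeta> (Z' h) = 0"
        using Z'[OF \<zeta>(1)] by auto
      moreover have "Z' h = 0" for h
        using beltrami_inv_beltrami[OF nrm[OF \<zeta>(1)], of "Z' h"] \<open>\<And>h. beltrami \<zeta> (Z' h) = 0\<close>
        by (simp add: beltrami_inv_def)
      then have "Z' = (\<lambda>h. 0)" ..
      ultimately show ?thesis by simp
    qed
    then have const: "Z x = Z y" if "x \<in> ball \<zeta>0 r" "y \<in> ball \<zeta>0 r" for x y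
      using has_derivative_zero_unique_connected[of "ball \<zeta>0 r" Z x y] that by auto
    let ?y = "\<zeta>0 + of_real (r / 2)"
    have y: "?y \<in> ball \<zeta>0 r" using r(1) by (simp add: dist_norm)
    have "Z \<zeta>0 = Z ?y"
      by (rule const[OF _ y]) (use r(1) in simp)
    moreover have "?y \<in> D" using y r(2) by blast
    ultimately have "\<zeta>0 = ?y"
      using inj_onD[OF bij_betw_imp_inj_on[OF bij]] \<zeta>0 by blast
    then show False using r(1) by simp
  qed
  then have "\<forall>z\<in>Z ` D. e z = 1" by blast
  then show ?thesis
    unfolding bij_betw_imp_surj_on[OF bij] eikonal_on_def e_def .
qed

section \<open>The representation theorem\<close>

text \<open>
  In the forward direction the exceptional set consists of the zeros of \<open>\<zeta>\<^sub>z\<close>. In the backward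
  direction, the points where the eikonal equation fails form an open subset of \<open>S\<close>, and a
  nonempty open set is not sparse.
\<close>

theorem theorem2p2:
  fixes \<Omega> :: "complex set" and u v :: "complex \<Rightarrow> real" and \<phi> :: "complex \<Rightarrow> complex"
  assumes "open \<Omega>" and "simply_connected \<Omega>"
    and "\<And>z. z \<in> \<Omega> \<Longrightarrow> \<phi> z = complex_of_real (u z) + \<i> * complex_of_real (v z)"
    and "C2_on \<phi> \<Omega>"
    and "\<And>z. z \<in> \<Omega> \<Longrightarrow> grad v z \<noteq> 0"
    and "eikonal_on \<phi> \<Omega> \<Longrightarrow> \<not> zeta \<phi> constant_on \<Omega>"
  shows "eikonal_on \<phi> \<Omega> \<longleftrightarrow>
    (\<exists>S. S \<subseteq> branch_points \<phi> \<Omega> \<and> S sparse_in \<Omega> \<and>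
      (\<forall>z0 \<in> \<Omega> - S. locally_parametrized_at \<phi> \<Omega> z0))"
proof
  assume eik: "eikonal_on \<phi> \<Omega>"
  have C1: "C1_on \<phi> \<Omega>" using assms(4) by (simp add: C2_on_def)
  interpret eikonal_solution \<phi> \<Omega>
  proof
    show "cmod (zeta \<phi> z) \<noteq> 1" if "z \<in> \<Omega>" for z
      using eikonal_cmod_zeta[OF eik that assms(1) C1 assms(3) assms(5)[OF that]] .
  qed (use assms eik simply_connected_imp_connected in auto)
  show "\<exists>S. S \<subseteq> branch_points \<phi> \<Omega> \<and> S sparse_in \<Omega> \<and>
      (\<forall>z0 \<in> \<Omega> - S. locally_parametrized_at \<phi> \<Omega> z0)"
    using critical_imp_branch_point critical_sparse locally_parametrized_regular
    by (intro exI[of _ "{z \<in> \<Omega>. \<zeta>\<^sub>z z = 0}"]) auto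
next
  assume "\<exists>S. S \<subseteq> branch_points \<phi> \<Omega> \<and> S sparse_in \<Omega> \<and>
      (\<forall>z0 \<in> \<Omega> - S. locally_parametrized_at \<phi> \<Omega> z0)"
  then obtain S where S: "S sparse_in \<Omega>"
    and par: "\<And>z0. z0 \<in> \<Omega> - S \<Longrightarrow> locally_parametrized_at \<phi> \<Omega> z0" by blast
  have C1: "C1_on \<phi> \<Omega>" using assms(4) by (simp add: C2_on_def)
  define e where "e z = (dx \<phi> z)\<^sup>2 + (dy \<phi> z)\<^sup>2" for z
  have off: "e z0 = 1" if "z0 \<in> \<Omega> - S" for z0
  proof -
    obtain U D f P where U: "open U" "z0 \<in> U" "U \<subseteq> \<Omega>" "open D" "parametrizes f P D U \<phi>"
      using par[OF \<open>z0 \<in> \<Omega> - S\<close>] unfolding locally_parametrized_at_def by blast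
    have "C1_on \<phi> U"
      using C1 U(3) unfolding C1_on_def by (meson continuous_on_subset subsetD)
    then show ?thesis
      using parametrized_eikonal[OF U(4,5)] U(2) by (simp add: eikonal_on_def e_def)
  qed
  have "continuous_on \<Omega> e"
    unfolding e_def using C1 by (intro continuous_intros) (auto simp: C1_on_def)
  then have "open (\<Omega> \<inter> e -` (- {1}))"
    by (rule continuous_open_preimage[OF _ assms(1)]) auto
  moreover have "\<Omega> \<inter> e -` (- {1}) \<subseteq> S" using off by auto
  ultimately have "z islimpt S" if "z \<in> \<Omega>" "e z \<noteq> 1" for z
    using that islimpt_subset[OF open_imp_islimpt[of "\<Omega> \<inter> e -` (- {1})" z]] by auto
  then show "eikonal_on \<phi> \<Omega>"
    using S unfolding sparse_in_open[OF assms(1)] eikonal_on_def e_def by blast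
qed

end
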